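(* For $\beta_{\mathrm{op}}\in\mathbb{R}$ and $\beta_{\mathrm{pl}}\in\mathbb{R}$, the operator $\mathcal{B}$ associated with the two-player soft stochastic game is an $L_\infty$-norm contraction map: for any two free energy vectors $\mathcal{V},\bar{\mathcal{V}}:\mathcal{S}\to\mathbb{R}$, $$\|\mathcal{B}\mathcal{V}-\mathcal{B}\bar{\mathcal{V}}\|_\infty\le\gamma\,\|\mathcal{V}-\bar{\mathcal{V}}\|_\infty ,$$ where $\gamma$ is the discount factor and $\|\mathcal V\|_\infty=\max_{\bm s\in\mathcal S}|\mathcal V(\bm s)|$.
   Context: Two-player stochastic game: $\mathcal{S}$ is a finite nonempty state space, $\mathcal{A}$ a finite nonempty action set used by both the player (pl) and the opponent (op), $\mathcal{R}_{\mathcal{G}}:\mathcal{S}\times\mathcal{A}\times\mathcal{A}\to\mathbb{R}$ the reward function, $\mathcal{T}_{\mathcal{G}}(\cdot\,|\,\bm s,\bm a^{\mathrm{pl}},\bm a^{\mathrm{op}})$ a probability distribution on $\mathcal{S}$ for each $(\bm s,\bm a^{\mathrm{pl}},\bm a^{\mathrm{op}})$, and $\gamma\in[0,1)$ the discount factor. A policy $\pi$ assigns to each $\bm s\in\mathcal{S}$ a probability distribution $\pi(\cdot|\bm s)$ on $\mathcal{A}$; $\pi_{\mathrm{pl}}$ and $\pi_{\mathrm{op}}$ denote policies of the player and the opponent. The reference policies $\rho_{\mathrm{pl}},\rho_{\mathrm{op}}$ are uniform on $\mathcal{A}$ in every state. A free energy vector is any function $\mathcal{V}:\mathcal{S}\to\mathbb{R}$.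 The free energy operator is $$f(\pi_{\mathrm{pl}},\pi_{\mathrm{op}},\bm s,\mathcal V)=\mathbb{E}\Big[\mathcal{R}_{\mathcal{G}}(\bm s,\bm a^{\mathrm{pl}},\bm a^{\mathrm{op}})+\gamma\,\mathbb{E}_{\bm s'\sim\mathcal{T}_{\mathcal{G}}(\cdot|\bm s,\bm a^{\mathrm{pl}},\bm a^{\mathrm{op}})}[\mathcal V(\bm s')]-\tfrac{1}{\beta_{\mathrm{pl}}}\log\tfrac{\pi_{\mathrm{pl}}(\bm a^{\mathrm{pl}}|\bm s)}{\rho_{\mathrm{pl}}(\bm a^{\mathrm{pl}}|\bm s)}-\tfrac{1}{\beta_{\mathrm{op}}}\log\tfrac{\pi_{\mathrm{op}}(\bm a^{\mathrm{op}}|\bm s)}{\rho_{\mathrm{op}}(\bm a^{\mathrm{op}}|\bm s)}\Big],$$ with outer expectation over independent $\bm a^{\mathrm{pl}}\sim\pi_{\mathrm{pl}}(\cdot|\bm s)$, $\bm a^{\mathrm{op}}\sim\pi_{\mathrm{op}}(\cdot|\bm s)$ (convention $0\log 0=0$). The value $\beta=0$ for an agent is read as the limiting case in which that agent simply uses its reference policy $\rho$ (its policy is fixed to $\rho$ and its logarithmic term is $0$). The symbol $\mathrm{ext}_{\pi_{\mathrm{op}}}$ means $\max_{\pi_{\mathrm{op}}}$ if $\beta_{\mathrm{op}}>0$ and $\min_{\pi_{\mathrm{op}}}$ if $\beta_{\mathrm{op}}<0$; for the player the operation is always $\max_{\pi_{\mathrm{pl}}}$. Set $$\mathcal{B}_{\mathrm{pl}}\mathcal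 V(\bm s)=\max_{\pi_{\mathrm{pl}}}\,\mathrm{ext}_{\pi_{\mathrm{op}}}f(\pi_{\mathrm{pl}},\pi_{\mathrm{op}},\bm s,\mathcal V),\qquad \mathcal{B}_{\mathrm{op}}\mathcal V(\bm s)=\mathrm{ext}_{\pi_{\mathrm{op}}}\max_{\pi_{\mathrm{pl}}}f(\pi_{\mathrm{pl}},\pi_{\mathrm{op}},\bm s,\mathcal V).$$ The authors assert that these two operators coincide, and $\mathcal B$ denotes the common operator, $\mathcal{B}\mathcal V(\bm s):=\mathcal{B}_{\mathrm{pl}}\mathcal V(\bm s)=\mathcal{B}_{\mathrm{op}}\mathcal V(\bm s)$. *)

theory Defs
  imports "HOL-Probability.Probability"
begin

type_synonym ('s, 'a) policy = "'s \<Rightarrow> 'a pmf"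

definition ref_policy :: "('s, 'a::finite) policy" where
  "ref_policy s = pmf_of_set UNIV"

text \<open>
  An agent with parameter \<open>\<beta> = 0\<close> is restricted to the reference policy; every other
  agent may use any policy.
\<close>

definition policies :: "real \<Rightarrow> ('s, 'a::finite) policy set" where
  "policies \<beta> = (if \<beta> = 0 then {ref_policy} else UNIV)"

text \<open>
  An action of probability \<open>0\<close> has weight \<open>0\<close> in the expectation, which is the convention
  \<open>0 log 0 = 0\<close>. For \<open>\<beta> = 0\<close> the logarithmic term vanishes, because \<open>1 / 0 = 0\<close>
  and also because then only \<open>ref_policy\<close> is used.
\<close>

definition free_energy ::
  "('s::finite \<Rightarrow> 'a::finite \<Rightarrow> 'a \<Rightarrow> real) \<Rightarrow> ('s \<Rightarrow> 'a \<Rightarrow> 'a \<Rightarrow> 's pmf) \<Rightarrow> real \<Rightarrow> real \<Rightarrow> real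
    \<Rightarrow> ('s, 'a) policy \<Rightarrow> ('s, 'a) policy \<Rightarrow> 's \<Rightarrow> ('s \<Rightarrow> real) \<Rightarrow> real" where
  "free_energy R T \<gamma> \<beta>pl \<beta>op \<pi>pl \<pi>op s V =
    measure_pmf.expectation (pair_pmf (\<pi>pl s) (\<pi>op s))
      (\<lambda>(a, b). R s a b + \<gamma> * measure_pmf.expectation (T s a b) V
        - 1 / \<beta>pl * ln (pmf (\<pi>pl s) a / pmf (ref_policy s) a)
        - 1 / \<beta>op * ln (pmf (\<pi>op s) b / pmf (ref_policy s) b))"

text \<open>
  Maxima and minima over the infinite set of policies are genuine (attained) extrema, hence
  \<open>GREATEST\<close> and \<open>LEAST\<close> rather than \<open>Sup\<close> and \<open>Inf\<close>.
\<close>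

definition max_over :: "'p set \<Rightarrow> ('p \<Rightarrow> real) \<Rightarrow> real" where
  "max_over P g = (GREATEST v. v \<in> g ` P)"

definition min_over :: "'p set \<Rightarrow> ('p \<Rightarrow> real) \<Rightarrow> real" where
  "min_over P g = (LEAST v. v \<in> g ` P)"

text \<open>For \<open>\<beta> = 0\<close> the set \<open>policies \<beta>\<close> is a singleton, so the choice of branch is immaterial.\<close>

definition ext_over :: "real \<Rightarrow> (('s, 'a::finite) policy \<Rightarrow> real) \<Rightarrow> real" where
  "ext_over \<beta> g = (if \<beta> < 0 then min_over (policies \<beta>) g else max_over (policies \<beta>) g)"

definition bellman_pl ::
  "('s::finite \<Rightarrow> 'a::finite \<Rightarrow> 'a \<Rightarrow> real) \<Rightarrow> ('s \<Rightarrow> 'a \<Rightarrow> 'a \<Rightarrow> 's pmf) \<Rightarrow> real \<Rightarrow> real \<Rightarrow> real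
    \<Rightarrow> ('s \<Rightarrow> real) \<Rightarrow> 's \<Rightarrow> real" where
  "bellman_pl R T \<gamma> \<beta>pl \<beta>op V s =
    max_over (policies \<beta>pl) (\<lambda>\<pi>pl :: ('s, 'a) policy.
      ext_over \<beta>op (\<lambda>\<pi>op. free_energy R T \<gamma> \<beta>pl \<beta>op \<pi>pl \<pi>op s V))"

definition bellman_op ::
  "('s::finite \<Rightarrow> 'a::finite \<Rightarrow> 'a \<Rightarrow> real) \<Rightarrow> ('s \<Rightarrow> 'a \<Rightarrow> 'a \<Rightarrow> 's pmf) \<Rightarrow> real \<Rightarrow> real \<Rightarrow> real
    \<Rightarrow> ('s \<Rightarrow> real) \<Rightarrow> 's \<Rightarrow> real" where
  "bellman_op R T \<gamma> \<beta>pl \<beta>op V s =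
    ext_over \<beta>op (\<lambda>\<pi>op :: ('s, 'a) policy.
      max_over (policies \<beta>pl) (\<lambda>\<pi>pl. free_energy R T \<gamma> \<beta>pl \<beta>op \<pi>pl \<pi>op s V))"

definition linf_norm :: "('s::finite \<Rightarrow> real) \<Rightarrow> real" where
  "linf_norm V = Max (range (\<lambda>s. \<bar>V s\<bar>))"

end

theory Submission
  imports Defs "HOL-Real_Asymp.Real_Asymp"
begin

text \<open>
  In a fixed state the free energy is a jointly continuous function of the two action
  distributions, which range over compact sets, so all extrema are attained. Any extremum is
  nonexpansive in the uniform norm. Applied to the inner extremum this gives its continuity in
  the outer policy; applied to both it bounds the effect of replacing \<open>V\<close> by \<open>W\<close>,
  which changes the free energy by at most \<open>\<gamma>\<close> times the distance. Convexity, and hence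
  the interchange of the two extrema, plays no role.
\<close>

section \<open>Attained extrema\<close>

text \<open>\<open>GREATEST\<close> is determined only when the extremum is attained, so every
  evaluation of \<open>max_over\<close> goes through an explicit maximizer.\<close>

lemma max_over_eq:
  assumes "p \<in> P" and "\<And>q. q \<in> P \<Longrightarrow> g q \<le> g p"
  shows "max_over P g = g p"
  unfolding max_over_def using assms by (intro Greatest_equality) auto

lemma min_over_eq:
  assumes "p \<in> P" and "\<And>q. q \<in> P \<Longrightarrow> g p \<le> g q"
  shows "min_over P g = g p"
  unfolding min_over_def using assms by (intro Least_equality) auto

text \<open>Evaluating both functions at a maximizer \<open>p\<close> of the first and
  \<open>r\<close> of the second gives \<open>F (e p) \<le> G (e p) + c \<le> G (e r) + c\<close>,
  and symmetrically; minima are alike. The index type carries no topology of its own: compactness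
  and continuity are asked of the image under \<open>e\<close>, which will be the projection of
  policies to the simplex.\<close>

lemma extremum_dist_le:
  fixes e :: "'p \<Rightarrow> 'x::topological_space"
  assumes opt: "opt = max_over P \<or> opt = min_over P"
    and ne: "P \<noteq> {}" and cmp: "compact (e ` P)"
    and F: "continuous_on (e ` P) F" and G: "continuous_on (e ` P) G"
    and le: "\<And>p. p \<in> P \<Longrightarrow> \<bar>F (e p) - G (e p)\<bar> \<le> c"
  shows "\<bar>opt (\<lambda>p. F (e p)) - opt (\<lambda>p. G (e p))\<bar> \<le> c"
  using opt
proof
  assume o: "opt = max_over P"
  obtain p where p: "p \<in> P" "\<And>q. q \<in> P \<Longrightarrow> F (e q) \<le> F (e p)"
    using continuous_attains_sup[OF cmp _ F] ne by auto
  obtain r where r: "r \<in> P" "\<And>q. q \<in> P \<Longrightarrow> G (e q) \<le> G (e r)"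
    using continuous_attains_sup[OF cmp _ G] ne by auto
  have "opt (\<lambda>p. F (e p)) = F (e p)" "opt (\<lambda>p. G (e p)) = G (e r)"
    using p r unfolding o by (auto intro!: max_over_eq)
  moreover have "\<bar>F (e p) - G (e r)\<bar> \<le> c"
    using le[OF p(1)] le[OF r(1)] p(2)[OF r(1)] r(2)[OF p(1)] by linarith
  ultimately show ?thesis by simp
next
  assume o: "opt = min_over P"
  obtain p where p: "p \<in> P" "\<And>q. q \<in> P \<Longrightarrow> F (e p) \<le> F (e q)"
    using continuous_attains_inf[OF cmp _ F] ne by auto
  obtain r where r: "r \<in> P" "\<And>q. q \<in> P \<Longrightarrow> G (e r) \<le> G (e q)"
    using continuous_attains_inf[OF cmp _ G] ne by auto
  have "opt (\<lambda>p. F (e p)) = F (e p)" "opt (\<lambda>p. G (e p)) = G (e r)"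
    using p r unfolding o by (auto intro!: min_over_eq)
  moreover have "\<bar>F (e p) - G (e r)\<bar> \<le> c"
    using le[OF p(1)] le[OF r(1)] p(2)[OF r(1)] r(2)[OF p(1)] by linarith
  ultimately show ?thesis by simp
qed

lemma continuous_on_section:
  assumes "continuous_on (K \<times> L) (\<lambda>(x, y). F x y)" and "x \<in> K"
  shows "continuous_on L (F x)"
proof -
  have "continuous_on L (\<lambda>y. case (x, y) of (x, y) \<Rightarrow> F x y)"
    by (rule continuous_on_compose2[OF assms(1)]) (use assms(2) in \<open>auto intro!: continuous_intros\<close>)
  then show ?thesis by simp
qed

lemma continuous_on_extremum:
  fixes d :: "'q \<Rightarrow> 'y::metric_space" and K :: "'x::metric_space set"
  assumes opt: "opt = max_over Q \<or> opt = min_over Q"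
    and ne: "Q \<noteq> {}" and cmp: "compact K" "compact (d ` Q)"
    and F: "continuous_on (K \<times> d ` Q) (\<lambda>(x, y). F x y)"
  shows "continuous_on K (\<lambda>x. opt (\<lambda>q. F x (d q)))"
  unfolding continuous_on_iff
proof (intro ballI allI impI)
  fix x and \<epsilon> :: real
  assume x: "x \<in> K" and "0 < \<epsilon>"
  have "uniformly_continuous_on (K \<times> d ` Q) (\<lambda>(x, y). F x y)"
    using F cmp by (intro compact_uniformly_continuous compact_Times)
  then obtain \<delta> where \<delta>: "0 < \<delta>"
    and D: "\<And>u v. u \<in> K \<times> d ` Q \<Longrightarrow> v \<in> K \<times> d ` Q \<Longrightarrow> dist v u < \<delta> \<Longrightarrow>
      dist (case v of (x, y) \<Rightarrow> F x y) (case u of (x, y) \<Rightarrow> F x y) < \<epsilon> / 2"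
    unfolding uniformly_continuous_on_def using \<open>0 < \<epsilon>\<close> by (meson half_gt_zero)
  have "dist (opt (\<lambda>q. F x' (d q))) (opt (\<lambda>q. F x (d q))) < \<epsilon>"
    if x': "x' \<in> K" and "dist x' x < \<delta>" for x'
  proof -
    \<comment> \<open>Half of \<epsilon> is used because \<open>extremum_dist_le\<close> yields only
      a non-strict bound.\<close>
    have "\<bar>F x' (d q) - F x (d q)\<bar> \<le> \<epsilon> / 2" if "q \<in> Q" for q
      using D[of "(x, d q)" "(x', d q)"] that x x' \<open>dist x' x < \<delta>\<close>
      by (auto simp: dist_Pair_Pair dist_real_def)
    then show ?thesis
      using extremum_dist_le[OF opt ne cmp(2) continuous_on_section[OF F x']
        continuous_on_section[OF F x], of "\<epsilon> / 2"] \<open>0 < \<epsilon>\<close>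
      by (auto simp: dist_real_def)
  qed
  with \<delta> show "\<exists>\<delta>>0. \<forall>x'\<in>K. dist x' x < \<delta> \<longrightarrow>
      dist (opt (\<lambda>q. F x' (d q))) (opt (\<lambda>q. F x (d q))) < \<epsilon>" by blast
qed

text \<open>\<open>extremum_dist_le\<close> is used twice: on the inner extremum for each fixed
  \<open>p\<close>, and then on the outer one, whose objective is continuous by
  \<open>continuous_on_extremum\<close>.\<close>

lemma nested_extremum_dist_le:
  fixes e :: "'p \<Rightarrow> 'x::metric_space" and d :: "'q \<Rightarrow> 'y::metric_space"
  assumes opt: "opt1 = max_over P \<or> opt1 = min_over P" "opt2 = max_over Q \<or> opt2 = min_over Q"
    and ne: "P \<noteq> {}" "Q \<noteq> {}" and cmp: "compact (e ` P)" "compact (d ` Q)"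
    and F: "continuous_on (e ` P \<times> d ` Q) (\<lambda>(x, y). F x y)"
    and G: "continuous_on (e ` P \<times> d ` Q) (\<lambda>(x, y). G x y)"
    and le: "\<And>p q. p \<in> P \<Longrightarrow> q \<in> Q \<Longrightarrow> \<bar>F (e p) (d q) - G (e p) (d q)\<bar> \<le> c"
  shows "\<bar>opt1 (\<lambda>p. opt2 (\<lambda>q. F (e p) (d q))) - opt1 (\<lambda>p. opt2 (\<lambda>q. G (e p) (d q)))\<bar> \<le> c"
proof (rule extremum_dist_le[OF opt(1) ne(1) cmp(1), where F = "\<lambda>x. opt2 (\<lambda>q. F x (d q))"
      and G = "\<lambda>x. opt2 (\<lambda>q. G x (d q))"])
  show "continuous_on (e ` P) (\<lambda>x. opt2 (\<lambda>q. F x (d q)))"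
    "continuous_on (e ` P) (\<lambda>x. opt2 (\<lambda>q. G x (d q)))"
    using continuous_on_extremum[OF opt(2) ne(2) cmp] F G by blast+
  show "\<bar>opt2 (\<lambda>q. F (e p) (d q)) - opt2 (\<lambda>q. G (e p) (d q))\<bar> \<le> c" if "p \<in> P" for p
    using extremum_dist_le[OF opt(2) ne(2) cmp(2) continuous_on_section[OF F]
        continuous_on_section[OF G]] le that
    by blast
qed

section \<open>Action distributions as points of the simplex\<close>

text \<open>The free energy at \<open>s\<close> sees a policy only through its distribution at
  \<open>s\<close>, so this projection loses nothing there and lands in a Euclidean space, where
  compactness is available.\<close>

definition prob_vec :: "'s \<Rightarrow> ('s, 'a::finite) policy \<Rightarrow> real ^ 'a" where
  "prob_vec s \<pi> = (\<chi> a. pmf (\<pi> s) a)"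

definition prob_simplex :: "(real ^ 'a::finite) set" where
  "prob_simplex = {x. (\<forall>a. 0 \<le> x $ a) \<and> (\<Sum>a\<in>UNIV. x $ a) = 1}"

lemma compact_prob_simplex: "compact (prob_simplex :: (real ^ 'a::finite) set)"
proof -
  have "prob_simplex = (\<Inter>a. {x :: real ^ 'a. 0 \<le> x $ a}) \<inter> {x. (\<Sum>a\<in>UNIV. x $ a) = 1}"
    by (auto simp: prob_simplex_def)
  moreover have "closed \<dots>"
    by (intro closed_Int closed_INT ballI closed_Collect_le closed_Collect_eq continuous_intros)
  moreover have "norm x \<le> 1" if "x \<in> prob_simplex" for x :: "real ^ 'a"
    using norm_le_l1_cart[of x] that by (simp add: prob_simplex_def)
  then have "bounded (prob_simplex :: (real ^ 'a) set)"
    by (auto simp: bounded_iff)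
  ultimately show ?thesis
    by (simp add: compact_eq_bounded_closed)
qed

lemma range_prob_vec: "range (prob_vec s) = prob_simplex"
proof (intro equalityI subsetI)
  fix x :: "real ^ 'a" assume "x \<in> range (prob_vec s)"
  then show "x \<in> prob_simplex"
    by (auto simp: prob_vec_def prob_simplex_def sum_pmf_eq_1)
next
  fix x :: "real ^ 'a" assume x: "x \<in> prob_simplex"
  then have "pmf (embed_pmf (($) x)) = ($) x"
    by (intro ext pmf_embed_pmf)
      (auto simp: prob_simplex_def nn_integral_count_space_finite sum_ennreal)
  \<comment> \<open>A state-independent policy serves as preimage, since only its value at
    \<open>s\<close> matters.\<close>
  then have "prob_vec s (\<lambda>_. embed_pmf (($) x)) = x"
    by (simp add: prob_vec_def vec_eq_iff)
  then show "x \<in> range (prob_vec s)" by (metis rangeI)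
qed

lemma policies_nonempty: "policies \<beta> \<noteq> {}"
  by (simp add: policies_def)

text \<open>The image is a single point for \<open>\<beta> = 0\<close> and the whole simplex
  otherwise.\<close>

lemma compact_prob_vec_policies: "compact (prob_vec s ` policies \<beta>)"
  by (simp add: policies_def range_prob_vec compact_prob_simplex)

section \<open>Free energy in a fixed state\<close>

text \<open>Each probability is multiplied into its own logarithm, so that the terms have the form
  \<open>t * ln (t * n)\<close>, which extends continuously to \<open>t = 0\<close>. The factor
  \<open>CARD('a)\<close> is the reciprocal of the uniform reference probability.\<close>

definition free_energy_vec ::
  "('s::finite \<Rightarrow> 'a::finite \<Rightarrow> 'a \<Rightarrow> real) \<Rightarrow> ('s \<Rightarrow> 'a \<Rightarrow> 'a \<Rightarrow> 's pmf) \<Rightarrow> real \<Rightarrow> real \<Rightarrow> real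
    \<Rightarrow> 's \<Rightarrow> ('s \<Rightarrow> real) \<Rightarrow> real ^ 'a \<Rightarrow> real ^ 'a \<Rightarrow> real" where
  "free_energy_vec R T \<gamma> \<beta>pl \<beta>op s V x y =
    (\<Sum>a\<in>UNIV. \<Sum>b\<in>UNIV.
      x $ a * y $ b * (R s a b + \<gamma> * measure_pmf.expectation (T s a b) V)
      - 1 / \<beta>pl * y $ b * (x $ a * ln (x $ a * CARD('a)))
      - 1 / \<beta>op * x $ a * (y $ b * ln (y $ b * CARD('a))))"

lemma free_energy_eq_vec:
  "free_energy R T \<gamma> \<beta>pl \<beta>op \<pi>pl \<pi>op s V =
    free_energy_vec R T \<gamma> \<beta>pl \<beta>op s V (prob_vec s \<pi>pl) (prob_vec s \<pi>op)"
proof -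
  let ?h = "\<lambda>a b. R s a b + \<gamma> * measure_pmf.expectation (T s a b) V
    - 1 / \<beta>pl * ln (pmf (\<pi>pl s) a / pmf (ref_policy s) a)
    - 1 / \<beta>op * ln (pmf (\<pi>op s) b / pmf (ref_policy s) b)"
  have "free_energy R T \<gamma> \<beta>pl \<beta>op \<pi>pl \<pi>op s V =
      (\<Sum>z\<in>UNIV \<times> UNIV. pmf (pair_pmf (\<pi>pl s) (\<pi>op s)) z * (case z of (a, b) \<Rightarrow> ?h a b))"
    unfolding free_energy_def by (subst integral_measure_pmf[where A = "UNIV \<times> UNIV"]) auto
  also have "\<dots> = (\<Sum>a\<in>UNIV. \<Sum>b\<in>UNIV. pmf (\<pi>pl s) a * pmf (\<pi>op s) b * ?h a b)"
    unfolding sum.cartesian_product by (intro sum.cong refl) (auto simp: pmf_pair)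
  also have "\<dots> = free_energy_vec R T \<gamma> \<beta>pl \<beta>op s V (prob_vec s \<pi>pl) (prob_vec s \<pi>op)"
    unfolding free_energy_vec_def prob_vec_def
    by (intro sum.cong refl) (simp add: ref_policy_def right_diff_distrib mult.assoc mult.left_commute)
  finally show ?thesis .
qed

lemma continuous_on_xlnx:
  fixes c :: real
  assumes "0 < c"
  shows "continuous_on {0..} (\<lambda>x. x * ln (x * c))"
  unfolding continuous_on_def
proof
  fix x :: real assume "x \<in> {0..}"
  then consider "x = 0" | "0 < x" by fastforce
  then show "((\<lambda>x. x * ln (x * c)) \<longlongrightarrow> x * ln (x * c)) (at x within {0..})"
  proof cases
    \<comment> \<open>The value at the boundary point is 0 because of the factor \<open>x\<close>,
      whatever \<open>ln 0\<close> is; it agrees with the one-sided limit.\<close>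
    case 1
    have "((\<lambda>x. x * ln (x * c)) \<longlongrightarrow> 0) (at_right 0)"
      using assms by real_asymp
    then show ?thesis
      using 1 by (simp add: at_within_Ici_at_right)
  next
    case 2
    then show ?thesis using assms by (auto intro!: tendsto_intros)
  qed
qed

lemma continuous_on_free_energy_vec:
  fixes R :: "'s::finite \<Rightarrow> 'a::finite \<Rightarrow> 'a \<Rightarrow> real"
  shows "continuous_on (prob_simplex \<times> prob_simplex)
    (\<lambda>(x, y). free_energy_vec R T \<gamma> \<beta>pl \<beta>op s V x y)"
proof -
  let ?S = "prob_simplex \<times> prob_simplex :: ((real ^ 'a) \<times> (real ^ 'a)) set"
  let ?n = "real CARD('a)"
  have coord: "continuous_on ?S (\<lambda>z. fst z $ a)" "continuous_on ?S (\<lambda>z. snd z $ a)" for a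
    by (intro continuous_intros)+
  \<comment> \<open>The entropy terms are known to be continuous only on the closed half-line, which
    contains the coordinates of simplex points.\<close>
  have nonneg: "(\<lambda>z. fst z $ a) ` ?S \<subseteq> {0..}" "(\<lambda>z. snd z $ a) ` ?S \<subseteq> {0..}" for a
    by (auto simp: prob_simplex_def)
  have cont: "continuous_on {0..} (\<lambda>x. x * ln (x * ?n))"
    by (rule continuous_on_xlnx) simp
  note xlnx = continuous_on_compose2[OF cont coord(1) nonneg(1)]
    continuous_on_compose2[OF cont coord(2) nonneg(2)]
  show ?thesis
    unfolding free_energy_vec_def case_prod_unfold
    by (intro xlnx coord continuous_on_const continuous_on_sum continuous_on_add
        continuous_on_diff continuous_on_mult)
qed

section \<open>Lipschitz dependence of the free energy on the value vector\<close>

lemma linf_norm_ge: "\<bar>V s\<bar> \<le> linf_norm V"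
  by (simp add: linf_norm_def)

lemma linf_norm_le: "(\<And>s. \<bar>V s\<bar> \<le> c) \<Longrightarrow> linf_norm V \<le> c"
  by (simp add: linf_norm_def)

lemma expectation_abs_le:
  fixes f :: "'b::finite \<Rightarrow> real"
  assumes "\<And>x. \<bar>f x\<bar> \<le> c"
  shows "\<bar>measure_pmf.expectation p f\<bar> \<le> c"
proof -
  have "\<bar>measure_pmf.expectation p f\<bar> \<le> measure_pmf.expectation p (\<lambda>x. \<bar>f x\<bar>)"
    by (rule integral_abs_bound)
  also have "\<dots> \<le> measure_pmf.expectation p (\<lambda>_. c)"
    using assms by (intro integral_mono integrable_measure_pmf_finite) auto
  finally show ?thesis by simp
qed

text \<open>With both policies fixed, rewards and logarithmic terms cancel; what remains is \<gamma>
  times an iterated average of \<open>V - W\<close>, and averaging does not increase the sup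
  norm.\<close>

lemma free_energy_dist_le:
  assumes "0 \<le> \<gamma>"
  shows "\<bar>free_energy R T \<gamma> \<beta>pl \<beta>op \<pi>pl \<pi>op s V - free_energy R T \<gamma> \<beta>pl \<beta>op \<pi>pl \<pi>op s W\<bar>
    \<le> \<gamma> * linf_norm (\<lambda>s. V s - W s)"
proof -
  have E: "measure_pmf.expectation p V - measure_pmf.expectation p W =
      measure_pmf.expectation p (\<lambda>s. V s - W s)" for p
    by (rule Bochner_Integration.integral_diff[symmetric])
      (auto intro!: integrable_measure_pmf_finite)
  have "free_energy R T \<gamma> \<beta>pl \<beta>op \<pi>pl \<pi>op s V - free_energy R T \<gamma> \<beta>pl \<beta>op \<pi>pl \<pi>op s W =
      measure_pmf.expectation (pair_pmf (\<pi>pl s) (\<pi>op s))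
        (\<lambda>(a, b). \<gamma> * measure_pmf.expectation (T s a b) (\<lambda>s. V s - W s))"
    unfolding free_energy_def E[symmetric]
    by (subst Bochner_Integration.integral_diff[symmetric])
      (auto intro!: integrable_measure_pmf_finite Bochner_Integration.integral_cong
        simp: algebra_simps)
  also have "\<bar>\<dots>\<bar> \<le> \<gamma> * linf_norm (\<lambda>s. V s - W s)"
    using assms
    by (intro expectation_abs_le)
      (auto simp: abs_mult intro!: mult_left_mono expectation_abs_le linf_norm_ge)
  finally show ?thesis .
qed

theorem theorem1:
  fixes R :: "'s::finite \<Rightarrow> 'a::finite \<Rightarrow> 'a \<Rightarrow> real"
    and T :: "'s \<Rightarrow> 'a \<Rightarrow> 'a \<Rightarrow> 's pmf"
    and \<gamma> \<beta>pl \<beta>op :: real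
    and V W :: "'s \<Rightarrow> real"
  assumes "0 \<le> \<gamma>" and "\<gamma> < 1"
  shows "linf_norm (\<lambda>s. bellman_pl R T \<gamma> \<beta>pl \<beta>op V s - bellman_pl R T \<gamma> \<beta>pl \<beta>op W s)
           \<le> \<gamma> * linf_norm (\<lambda>s. V s - W s) \<and>
         linf_norm (\<lambda>s. bellman_op R T \<gamma> \<beta>pl \<beta>op V s - bellman_op R T \<gamma> \<beta>pl \<beta>op W s)
           \<le> \<gamma> * linf_norm (\<lambda>s. V s - W s)"
proof (intro conjI linf_norm_le)
  fix s
  define f where "f U = free_energy_vec R T \<gamma> \<beta>pl \<beta>op s U" for U
  let ?c = "\<gamma> * linf_norm (\<lambda>s. V s - W s)"
  let ?K = "\<lambda>\<beta>. prob_vec s ` (policies \<beta> :: ('s, 'a) policy set)"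
  \<comment> \<open>The case \<open>\<beta>op = 0\<close> is covered as a maximum over the single
    reference policy.\<close>
  have ext: "ext_over \<beta>op = (max_over (policies \<beta>op) :: (('s, 'a) policy \<Rightarrow> real) \<Rightarrow> real) \<or>
      ext_over \<beta>op = (min_over (policies \<beta>op) :: (('s, 'a) policy \<Rightarrow> real) \<Rightarrow> real)"
    by (cases "\<beta>op < 0") (auto simp: ext_over_def fun_eq_iff)
  have K: "?K \<beta> \<subseteq> prob_simplex" for \<beta>
    unfolding range_prob_vec[of s, symmetric] by (rule image_mono) simp
  have cont: "continuous_on (?K \<beta>pl \<times> ?K \<beta>op) (\<lambda>(x, y). f U x y)" for U
    unfolding f_def
    by (rule continuous_on_subset[OF continuous_on_free_energy_vec Sigma_mono]) (rule K)+
  \<comment> \<open>For \<open>bellman_op\<close> the opponent's policy is the outer variable, so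
    the two factors are swapped.\<close>
  have cont': "continuous_on (?K \<beta>op \<times> ?K \<beta>pl) (\<lambda>(y, x). f U x y)" for U
  proof -
    have "continuous_on (?K \<beta>op \<times> ?K \<beta>pl) (\<lambda>z. case prod.swap z of (x, y) \<Rightarrow> f U x y)"
      by (rule continuous_on_compose2[OF cont continuous_on_swap]) (simp add: product_swap)
    then show ?thesis by (simp add: case_prod_unfold)
  qed
  have le: "\<bar>f V (prob_vec s p) (prob_vec s q) - f W (prob_vec s p) (prob_vec s q)\<bar> \<le> ?c" for p q
    using free_energy_dist_le[OF assms(1), of R T \<beta>pl \<beta>op p q s V W]
    by (simp add: f_def free_energy_eq_vec)
  \<comment> \<open>A trivial disjunction, put in the shape that
    \<open>nested_extremum_dist_le\<close> expects; exchanging it with \<open>ext\<close> switches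
    between the two operators.\<close>
  have pl: "max_over (policies \<beta>pl) = (max_over (policies \<beta>pl) :: (('s, 'a) policy \<Rightarrow> real) \<Rightarrow> real) \<or>
      max_over (policies \<beta>pl) = (min_over (policies \<beta>pl) :: (('s, 'a) policy \<Rightarrow> real) \<Rightarrow> real)"
    by simp
  note facts = policies_nonempty policies_nonempty
    compact_prob_vec_policies compact_prob_vec_policies
  show "\<bar>bellman_pl R T \<gamma> \<beta>pl \<beta>op V s - bellman_pl R T \<gamma> \<beta>pl \<beta>op W s\<bar> \<le> ?c"
    unfolding bellman_pl_def free_energy_eq_vec f_def[symmetric]
    by (rule nested_extremum_dist_le[OF pl ext facts cont cont le])
  show "\<bar>bellman_op R T \<gamma> \<beta>pl \<beta>op V s - bellman_op R T \<gamma> \<beta>pl \<beta>op W s\<bar> \<le> ?c"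
    unfolding bellman_op_def free_energy_eq_vec f_def[symmetric]
    by (rule nested_extremum_dist_le[OF ext pl facts cont' cont' le])
qed

end
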